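(* Let $R$ be a ring and $x$ an indeterminate over $R$. Then there exists an infinite chain $\cdots\subset R_2\subset R_1\subset R_0=R[x]$, where each $R_i$ is a maximal subring of $R_{i-1}$ and $R[x]$ is integral over each $R_i$, for $i\geq 1$.
   Context: All rings are commutative with $1\neq 0$ and subrings are unital. A proper subring $S$ of a ring $R$ is a maximal subring of $R$ if it is maximal with respect to inclusion among all proper subrings of $R$. *)

theory Defs
  imports "HOL-Algebra.Subrings" "HOL-Algebra.UnivPoly"
begin

definition maximal_subring :: "'a set \<Rightarrow> ('a, 'm) ring_scheme \<Rightarrow> bool" where
  "maximal_subring S A \<longleftrightarrow>
     subring S A \<and> S \<noteq> carrier A \<and>
     (\<forall>T. subring T A \<and> T \<noteq> carrier A \<and> S \<subseteq> T \<longrightarrow> T = S)"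

(* a is a root of a monic polynomial X^n + c_(n-1) X^(n-1) + ... + c_0 with coefficients in S *)
definition integral_element :: "('a, 'm) ring_scheme \<Rightarrow> 'a set \<Rightarrow> 'a \<Rightarrow> bool" where
  "integral_element A S a \<longleftrightarrow>
     (\<exists>n c. 0 < n \<and> c \<in> {..<n} \<rightarrow> S \<and>
        a [^]\<^bsub>A\<^esub> (n::nat) \<oplus>\<^bsub>A\<^esub> (\<Oplus>\<^bsub>A\<^esub>i\<in>{..<n}. c i \<otimes>\<^bsub>A\<^esub> a [^]\<^bsub>A\<^esub> i) = \<zero>\<^bsub>A\<^esub>)"

definition integral_over :: "('a, 'm) ring_scheme \<Rightarrow> 'a set \<Rightarrow> bool" where
  "integral_over A S \<longleftrightarrow> subring S A \<and> (\<forall>a\<in>carrier A. integral_element A S a)"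

end

theory Submission
  imports Defs
begin

text \<open>
  Fix a maximal ideal \<open>M\<close> of \<open>R\<close> and let \<open>R\<^sub>n\<close> consist of the polynomials whose coefficients in
  degrees \<open>1, \<dots>, n\<close> lie in \<open>M\<close>; equivalently \<open>R\<^sub>n\<close> is the preimage of \<open>K + x\<^sup>n\<^sup>+\<^sup>1 K[x]\<close> under
  \<open>R[x] \<rightarrow> K[x]\<close>, where \<open>K = R/M\<close>. Each \<open>R\<^sub>n\<close> is a subring containing the constants, since
  in a product the coefficient of degree \<open>j \<in> {1, \<dots>, n}\<close> is a sum of terms each of which has a
  factor that is a coefficient of degree between \<open>1\<close> and \<open>j\<close>.

  Maximality: modulo \<open>R\<^sub>n\<^sub>+\<^sub>1\<close> an element of \<open>R\<^sub>n\<close> is determined by its coefficient of degree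
  \<open>n + 1\<close> modulo \<open>M\<close>, so \<open>R\<^sub>n / R\<^sub>n\<^sub>+\<^sub>1\<close> is one-dimensional over the field \<open>K\<close>; a ring between
  the two contains the constants, hence gives a \<open>K\<close>-subspace of that line
  (\<open>truncation_ring_maximal\<close>).

  Integrality: for a polynomial \<open>f\<close> with constant term \<open>a\<close>, the power \<open>(f - a)\<^sup>n\<^sup>+\<^sup>1\<close> is divisible by
  \<open>x\<^sup>n\<^sup>+\<^sup>1\<close> and so lies in \<open>R\<^sub>n\<close>. Thus \<open>f\<close> is a root of \<open>(T - a)\<^sup>n\<^sup>+\<^sup>1 - (f - a)\<^sup>n\<^sup>+\<^sup>1\<close>, which is monic
  with coefficients in \<open>R\<^sub>n\<close> (\<open>integral_if_shifted_power_in_subring\<close>).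
\<close>

section \<open>Maximal ideals\<close>

lemma (in ring) ideal_Union_chain:
  assumes "\<C> \<noteq> {}" "\<And>I. I \<in> \<C> \<Longrightarrow> ideal I R"
    and chain: "\<And>I J. \<lbrakk>I \<in> \<C>; J \<in> \<C>\<rbrakk> \<Longrightarrow> I \<subseteq> J \<or> J \<subseteq> I"
  shows "ideal (\<Union>\<C>) R"
proof (rule idealI[OF ring_axioms])
  show "subgroup (\<Union>\<C>) (add_monoid R)"
  proof (rule add.subgroupI)
    show "\<Union>\<C> \<subseteq> carrier R"
      using assms(2) by (meson Sup_least additive_subgroup.a_subset ideal.axioms(1))
    show "\<Union>\<C> \<noteq> {}"
      using assms(1,2) additive_subgroup.zero_closed ideal.axioms(1) by fastforce
    show "\<ominus> a \<in> \<Union>\<C>" if "a \<in> \<Union>\<C>" for a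
      using that assms(2) by (meson Union_iff additive_subgroup.a_inv_closed ideal.axioms(1) abelian_group_axioms)
    show "a \<oplus> b \<in> \<Union>\<C>" if "a \<in> \<Union>\<C>" "b \<in> \<Union>\<C>" for a b
    proof -
      from that obtain I J where IJ: "I \<in> \<C>" "a \<in> I" "J \<in> \<C>" "b \<in> J" by blast
      then obtain L where "L \<in> \<C>" "a \<in> L" "b \<in> L" using chain[of I J] by blast
      then show ?thesis
        using assms(2) additive_subgroup.a_closed ideal.axioms(1) by (metis UnionI)
    qed
  qed
  show "x \<otimes> a \<in> \<Union>\<C>" if "a \<in> \<Union>\<C>" "x \<in> carrier R" for a x
    using that assms(2) ideal.I_l_closed by (metis Union_iff)
  show "a \<otimes> x \<in> \<Union>\<C>" if "a \<in> \<Union>\<C>" "x \<in> carrier R" for a x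
    using that assms(2) ideal.I_r_closed by (metis Union_iff)
qed

text \<open>
  Krull: Zorn's lemma applied to the ideals that avoid \<open>\<one>\<close>. Properness is phrased this way because
  it visibly passes to unions of chains.
\<close>
lemma (in cring) exists_maximalideal:
  assumes "\<one> \<noteq> \<zero>"
  shows "\<exists>M. maximalideal M R"
proof -
  define \<A> where "\<A> = {I. ideal I R \<and> \<one> \<notin> I}"
  have "{\<zero>} \<in> \<A>" using assms by (simp add: \<A>_def zeroideal)
  moreover have "\<Union>\<C> \<in> \<A>" if "\<C> \<noteq> {}" "subset.chain \<A> \<C>" for \<C>
  proof -
    have "ideal (\<Union>\<C>) R"
      using that by (intro ideal_Union_chain) (auto simp: subset_chain_def \<A>_def)
    with that show ?thesis by (auto simp: subset_chain_def \<A>_def)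
  qed
  ultimately obtain M where M: "M \<in> \<A>" "\<And>X. \<lbrakk>X \<in> \<A>; M \<subseteq> X\<rbrakk> \<Longrightarrow> X = M"
    using subset_Zorn_nonempty[of \<A>] by blast
  have "maximalideal M R"
  proof (rule maximalidealI)
    show "ideal M R" "carrier R \<noteq> M" using M(1) by (auto simp: \<A>_def)
    fix J assume J: "ideal J R" "M \<subseteq> J" "J \<subseteq> carrier R"
    show "J = M \<or> J = carrier R"
      using M(2)[of J] J ideal.one_imp_carrier by (fastforce simp: \<A>_def)
  qed
  then show ?thesis ..
qed

text \<open>
  The ideal \<open>M + (a)\<close> is the whole ring, so \<open>\<one> = m + r a\<close> for some \<open>m \<in> M\<close>. This is the fact that
  \<open>R/M\<close> is a field, in terms of representatives.
\<close>
lemma (in cring) maximalideal_inverse_mod: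
  assumes "maximalideal M R" "a \<in> carrier R" "a \<notin> M"
  shows "\<exists>r\<in>carrier R. r \<otimes> a \<ominus> \<one> \<in> M"
proof -
  interpret M: maximalideal M R by fact
  let ?J = "M <+>\<^bsub>R\<^esub> PIdl a"
  have pa: "ideal (PIdl a) R" "a \<in> PIdl a"
    using assms(2) by (simp_all add: cgenideal_ideal cgenideal_self)
  have J: "ideal ?J R" using add_ideals[OF M.is_ideal pa(1)] .
  have elem: "m \<oplus> b \<in> ?J" if "m \<in> M" "b \<in> PIdl a" for m b
    using that by (auto simp: set_add_def set_mult_def)
  have "M \<subseteq> ?J"
  proof
    fix m assume "m \<in> M"
    then show "m \<in> ?J"
      using elem[of m \<zero>] additive_subgroup.zero_closed[OF ideal.axioms(1)[OF pa(1)]] M.a_subset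
      by auto
  qed
  moreover have "a \<in> ?J"
    using elem[of \<zero> a] pa assms(2) by simp
  ultimately have "?J = carrier R"
    using M.I_maximal[OF J] assms(3) additive_subgroup.a_subset[OF ideal.axioms(1)[OF J]] by blast
  then have "\<one> \<in> ?J" by simp
  then obtain m r where mr: "m \<in> M" "r \<in> carrier R" "\<one> = m \<oplus> r \<otimes> a"
    by (auto simp: set_add_def set_mult_def cgenideal_def)
  have mc: "m \<in> carrier R" using mr(1) M.a_subset by blast
  have "r \<otimes> a \<ominus> \<one> = \<ominus> m"
    unfolding mr(3) using mc mr(2) assms(2) by algebra
  then have "r \<otimes> a \<ominus> \<one> \<in> M"
    using mr(1) M.a_inv_closed by simp
  with mr(2) show ?thesis by blast
qed

section \<open>Integrality from powers of a translate\<close>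

text \<open>
  The expansion of \<open>(T - s)\<^sup>n\<close> at \<open>a\<close>. Taking the coefficient sequence to be total and zero beyond
  degree \<open>n\<close> makes multiplication by \<open>a - s\<close> a single formula, namely shift minus \<open>s\<close> times.
\<close>
lemma (in cring) power_translate_expansion:
  assumes S: "subring S R" and a: "a \<in> carrier R" and s: "s \<in> S"
  shows "\<exists>c. (\<forall>i. c i \<in> S) \<and> c n = \<one> \<and> (\<forall>i>n. c i = \<zero>) \<and>
             (a \<ominus> s) [^] (n::nat) = (\<Oplus>i\<in>{..n}. c i \<otimes> a [^] i)"
proof (induction n)
  case 0
  show ?case
    by (rule exI[of _ "\<lambda>i. if i = 0 then \<one> else \<zero>"]) (simp add: subringE[OF S])
next
  case (Suc n)
  then obtain c where c: "\<And>i. c i \<in> S" "c n = \<one>" "\<And>i. i > n \<Longrightarrow> c i = \<zero>"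
    and eq: "(a \<ominus> s) [^] n = (\<Oplus>i\<in>{..n}. c i \<otimes> a [^] i)" by blast
  have SR: "x \<in> S \<Longrightarrow> x \<in> carrier R" for x using subringE(1)[OF S] by blast
  note cR = SR[OF c(1)] and sR = SR[OF s]
  define sh where "sh i = (case i of 0 \<Rightarrow> \<zero> | Suc j \<Rightarrow> c j)" for i
  define e where "e i = sh i \<ominus> s \<otimes> c i" for i
  let ?p = "\<Oplus>i\<in>{..n}. c i \<otimes> a [^] i"
  have shS: "sh i \<in> S" for i using c(1) subringE(2)[OF S] by (auto simp: sh_def split: nat.split)
  note shR = SR[OF shS]
  have pR: "?p \<in> carrier R" using cR a by (auto intro!: finsum_closed)
  have shift: "(\<Oplus>i\<in>{..Suc n}. sh i \<otimes> a [^] i) = ?p \<otimes> a"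
  proof -
    have "(\<Oplus>i\<in>{..Suc n}. sh i \<otimes> a [^] i) = (\<Oplus>i\<in>{..n}. sh (Suc i) \<otimes> a [^] Suc i) \<oplus> sh 0 \<otimes> a [^] (0::nat)"
      using shR a by (intro finsum_Suc2) auto
    also have "\<dots> = (\<Oplus>i\<in>{..n}. c i \<otimes> a [^] i \<otimes> a)"
      using cR a by (simp add: sh_def m_assoc)
    also have "\<dots> = ?p \<otimes> a"
      using cR a by (intro finsum_ldistr[symmetric]) auto
    finally show ?thesis .
  qed
  have top: "(\<Oplus>i\<in>{..Suc n}. c i \<otimes> a [^] i) = ?p"
    using cR a c(3)[of "Suc n"] pR by (subst finsum_Suc) auto
  have "(\<Oplus>i\<in>{..Suc n}. e i \<otimes> a [^] i)
      = (\<Oplus>i\<in>{..Suc n}. sh i \<otimes> a [^] i \<oplus> (\<ominus> s) \<otimes> (c i \<otimes> a [^] i))"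
  proof (rule finsum_cong')
    fix i :: nat
    have "a [^] i \<in> carrier R" using a by simp
    then show "e i \<otimes> a [^] i = sh i \<otimes> a [^] i \<oplus> (\<ominus> s) \<otimes> (c i \<otimes> a [^] i)"
      using cR[of i] shR[of i] sR unfolding e_def by algebra
  qed (use shR cR sR a in auto)
  also have "\<dots> = (\<Oplus>i\<in>{..Suc n}. sh i \<otimes> a [^] i) \<oplus> (\<Oplus>i\<in>{..Suc n}. (\<ominus> s) \<otimes> (c i \<otimes> a [^] i))"
    using shR cR sR a by (intro finsum_addf) auto
  also have "(\<Oplus>i\<in>{..Suc n}. (\<ominus> s) \<otimes> (c i \<otimes> a [^] i)) = (\<ominus> s) \<otimes> (\<Oplus>i\<in>{..Suc n}. c i \<otimes> a [^] i)"
    using cR sR a by (intro finsum_rdistr[symmetric]) auto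
  also have "(\<Oplus>i\<in>{..Suc n}. sh i \<otimes> a [^] i) \<oplus> (\<ominus> s) \<otimes> (\<Oplus>i\<in>{..Suc n}. c i \<otimes> a [^] i)
      = ?p \<otimes> (a \<ominus> s)"
    unfolding shift top using pR a sR by (simp add: a_minus_def r_distr m_comm[of _ a] m_comm[of _ "\<ominus> s"])
  finally have "(a \<ominus> s) [^] Suc n = (\<Oplus>i\<in>{..Suc n}. e i \<otimes> a [^] i)"
    by (simp add: eq)
  moreover have "e i \<in> S" for i
    using shS c(1) s by (simp add: e_def a_minus_def subringE[OF S])
  moreover have "e (Suc n) = \<one>" "\<And>i. i > Suc n \<Longrightarrow> e i = \<zero>"
    using c(2,3) sR by (auto simp: e_def sh_def a_minus_def split: nat.split)
  ultimately show ?case by blast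
qed

text \<open>
  If \<open>w = (a - s)\<^sup>n\<close> lies in \<open>S\<close>, then \<open>a\<close> is a root of \<open>(T - s)\<^sup>n - w\<close>: only the constant
  coefficient of the expansion has to be corrected.
\<close>
lemma (in cring) integral_if_shifted_power_in_subring:
  assumes S: "subring S R" and a: "a \<in> carrier R" and s: "s \<in> S"
    and n: "0 < n" and w: "(a \<ominus> s) [^] (n::nat) \<in> S"
  shows "integral_element R S a"
proof -
  let ?w = "(a \<ominus> s) [^] n"
  obtain c where c: "\<And>i. c i \<in> S" "c n = \<one>" and eq: "?w = (\<Oplus>i\<in>{..n}. c i \<otimes> a [^] i)"
    using power_translate_expansion[OF S a s, of n] by blast
  have SR: "x \<in> S \<Longrightarrow> x \<in> carrier R" for x using subringE(1)[OF S] by blast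
  note cR = SR[OF c(1)] and wR = SR[OF w]
  define c' where "c' = c(0 := c 0 \<ominus> ?w)"
  define q where "q = (\<Oplus>i\<in>{1..<n}. c i \<otimes> a [^] i)"
  have qR: "q \<in> carrier R" unfolding q_def using cR a by (auto intro!: finsum_closed)
  have low: "{..<n} = insert 0 {1..<n}" using n by auto
  have c'q: "(\<Oplus>i\<in>{1..<n}. c' i \<otimes> a [^] i) = q"
    unfolding q_def using cR a by (intro finsum_cong') (auto simp: c'_def)
  have c'R: "c' i \<in> carrier R" for i using cR wR by (simp add: c'_def)
  have "(\<Oplus>i\<in>{..<n}. c' i \<otimes> a [^] i) = (c 0 \<ominus> ?w) \<oplus> q"
    unfolding low using c'R a c'q cR wR by (subst finsum_insert) (auto simp: c'_def)
  moreover have "(\<Oplus>i\<in>{..<n}. c i \<otimes> a [^] i) = c 0 \<oplus> q"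
    unfolding low q_def using cR a by (subst finsum_insert) auto
  moreover have "?w = a [^] n \<oplus> (\<Oplus>i\<in>{..<n}. c i \<otimes> a [^] i)"
  proof -
    have top: "{..n} = insert n {..<n}" by auto
    show ?thesis
      unfolding eq top using cR a c(2) by (subst finsum_insert) auto
  qed
  ultimately have "a [^] n \<oplus> (\<Oplus>i\<in>{..<n}. c' i \<otimes> a [^] i) = a [^] n \<oplus> ((c 0 \<ominus> ?w) \<oplus> q)"
    and wq: "?w = a [^] n \<oplus> (c 0 \<oplus> q)" by simp_all
  moreover have "a [^] n \<oplus> ((c 0 \<ominus> ?w) \<oplus> q) = (a [^] n \<oplus> (c 0 \<oplus> q)) \<ominus> ?w"
  proof -
    have "a [^] n \<in> carrier R" using a by simp
    then show ?thesis using cR[of 0] wR qR by algebra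
  qed
  ultimately have "a [^] n \<oplus> (\<Oplus>i\<in>{..<n}. c' i \<otimes> a [^] i) = \<zero>"
    using wR by (simp add: wq[symmetric] r_neg a_minus_def)
  moreover have "c' \<in> {..<n} \<rightarrow> S"
    using c(1) w by (auto simp: c'_def a_minus_def subringE[OF S])
  ultimately show ?thesis
    unfolding integral_element_def using n by blast
qed

section \<open>Nested subrings and sums in ideals\<close>

lemma (in ring) subring_trans:
  assumes D: "subring D R" and T: "subring T (R\<lparr>carrier := D\<rparr>)"
  shows "subring T R"
proof -
  interpret D: ring "R\<lparr>carrier := D\<rparr>" using subring_is_ring[OF D] .
  have "T \<subseteq> D" using subringE(1)[OF T] by simp
  then show ?thesis
    using D.subring_is_ring[OF T] subringE(1)[OF D] by (intro ring_incl_imp_subring) auto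
qed

lemma (in ring) subring_restrict:
  assumes D: "subring D R" and T: "subring T R" "T \<subseteq> D"
  shows "subring T (R\<lparr>carrier := D\<rparr>)"
proof -
  interpret D: ring "R\<lparr>carrier := D\<rparr>" using subring_is_ring[OF D] .
  show ?thesis
    using subring_is_ring[OF T(1)] T(2) by (intro D.ring_incl_imp_subring) auto
qed

lemma (in ideal) finsum_in_ideal:
  assumes "finite A" "\<And>i. i \<in> A \<Longrightarrow> f i \<in> I"
  shows "finsum R f A \<in> I"
  using assms
proof (induction rule: finite_induct)
  case (insert x A)
  then have "finsum R f (insert x A) = f x \<oplus> finsum R f A"
    using a_subset by (intro finsum_insert) auto
  with insert show ?case by simp
qed simp

section \<open>Polynomials with low coefficients in an ideal\<close>

context UP_cring
begin

definition truncation_ring :: "'a set \<Rightarrow> nat \<Rightarrow> (nat \<Rightarrow> 'a) set" where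
  "truncation_ring M n = {f \<in> carrier P. \<forall>j. 1 \<le> j \<and> j \<le> n \<longrightarrow> coeff P f j \<in> M}"

lemma truncation_ring_zero: "truncation_ring M 0 = carrier P"
  by (auto simp: truncation_ring_def)

lemma truncation_ring_carrier: "truncation_ring M n \<subseteq> carrier P"
  by (auto simp: truncation_ring_def)

lemma truncation_ring_decreasing: "truncation_ring M (Suc n) \<subseteq> truncation_ring M n"
  by (auto simp: truncation_ring_def)

lemma const_in_truncation_ring:
  assumes "ideal M R" "a \<in> carrier R"
  shows "monom P a 0 \<in> truncation_ring M n"
  using assms(2) additive_subgroup.zero_closed[OF ideal.axioms(1)[OF assms(1)]]
  by (auto simp: truncation_ring_def)

lemma truncation_ring_subring:
  assumes "ideal M R"
  shows "subring (truncation_ring M n) P"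
proof -
  interpret M: ideal M R by fact
  show ?thesis
  proof (rule P.subringI)
    show "truncation_ring M n \<subseteq> carrier P" by (rule truncation_ring_carrier)
    show "\<one>\<^bsub>P\<^esub> \<in> truncation_ring M n" by (auto simp: truncation_ring_def)
    show "\<ominus>\<^bsub>P\<^esub> f \<in> truncation_ring M n" if "f \<in> truncation_ring M n" for f
      using that by (auto simp: truncation_ring_def)
    show "f \<oplus>\<^bsub>P\<^esub> g \<in> truncation_ring M n"
      if "f \<in> truncation_ring M n" "g \<in> truncation_ring M n" for f g
      using that by (auto simp: truncation_ring_def)
    show "f \<otimes>\<^bsub>P\<^esub> g \<in> truncation_ring M n"
      if fg: "f \<in> truncation_ring M n" "g \<in> truncation_ring M n" for f g
    proof -
      have car: "f \<in> carrier P" "g \<in> carrier P" using fg by (auto simp: truncation_ring_def)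
      have "coeff P (f \<otimes>\<^bsub>P\<^esub> g) j \<in> M" if j: "1 \<le> j" "j \<le> n" for j
      proof -
        have "coeff P f i \<otimes> coeff P g (j - i) \<in> M" if "i \<le> j" for i
        proof (cases "i = 0")
          case True
          then have "coeff P g (j - i) \<in> M" using fg j by (auto simp: truncation_ring_def)
          then show ?thesis using car by (simp add: M.I_l_closed)
        next
          case False
          then have "coeff P f i \<in> M" using fg j that by (auto simp: truncation_ring_def)
          then show ?thesis using car by (simp add: M.I_r_closed)
        qed
        then show ?thesis using car by (auto intro!: M.finsum_in_ideal)
      qed
      then show ?thesis using car by (auto simp: truncation_ring_def)
    qed
  qed
qed

text \<open>
  The monomial \<open>x\<^sup>n\<^sup>+\<^sup>1\<close> lies in the larger ring only. Conversely, adjoining to the smaller ring any other element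
  \<open>f\<close> of the larger one yields \<open>x\<^sup>n\<^sup>+\<^sup>1\<close>: invert the coefficient of degree \<open>n + 1\<close> modulo \<open>M\<close> by a constant \<open>r\<close>, and
  \<open>r f\<close> agrees with \<open>x\<^sup>n\<^sup>+\<^sup>1\<close> up to an element of the smaller ring. Constants times \<open>x\<^sup>n\<^sup>+\<^sup>1\<close> then
  exhaust the larger ring modulo the smaller one.
\<close>
lemma truncation_ring_maximal:
  assumes max: "maximalideal M R"
  shows "truncation_ring M (Suc n) \<subset> truncation_ring M n"
    and "maximal_subring (truncation_ring M (Suc n)) (P\<lparr>carrier := truncation_ring M n\<rparr>)"
proof -
  interpret M: maximalideal M R by fact
  let ?A = "truncation_ring M n" and ?B = "truncation_ring M (Suc n)"
  let ?x = "monom P \<one> (Suc n)"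
  have one: "\<one> \<notin> M" using M.one_imp_carrier M.I_notcarr by blast
  have "?x \<in> ?A" by (auto simp: truncation_ring_def)
  moreover have "?x \<notin> ?B" using one by (auto simp: truncation_ring_def)
  ultimately show strict: "?B \<subset> ?A" using truncation_ring_decreasing[of M n] by blast
  note subA = truncation_ring_subring[OF M.is_ideal, of n]
    and subB = truncation_ring_subring[OF M.is_ideal, of "Suc n"]
  have "T = ?A"
    if T: "subring T (P\<lparr>carrier := ?A\<rparr>)" and BT: "?B \<subseteq> T" and ne: "T \<noteq> ?B" for T
  proof -
    note subT = P.subring_trans[OF subA T]
    have TA: "T \<subseteq> ?A" using subringE(1)[OF T] by simp
    obtain f where f: "f \<in> T" "f \<notin> ?B" using BT ne by blast
    have fA: "f \<in> ?A" using f TA by blast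
    have fP: "f \<in> carrier P" using fA truncation_ring_carrier by blast
    have "coeff P f (Suc n) \<notin> M"
      using f(2) fA by (auto simp: truncation_ring_def le_Suc_eq)
    then obtain r where r: "r \<in> carrier R" "r \<otimes> coeff P f (Suc n) \<ominus> \<one> \<in> M"
      using R.maximalideal_inverse_mod[OF max coeff_closed[OF fP]] by blast
    let ?c = "\<lambda>a. monom P a 0"
    have cT: "?c a \<in> T" if "a \<in> carrier R" for a
      using const_in_truncation_ring[OF M.is_ideal that] BT by blast
    let ?rf = "?c r \<otimes>\<^bsub>P\<^esub> f"
    have rfT: "?rf \<in> T" using subringE(6)[OF subT] cT r f by blast
    \<comment> \<open>the coefficient of degree \<open>n + 1\<close> lies in \<open>M\<close> by the choice of \<open>r\<close>\<close>
    have "?rf \<ominus>\<^bsub>P\<^esub> ?x \<in> ?B"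
    proof -
      have "coeff P (?rf \<ominus>\<^bsub>P\<^esub> ?x) j \<in> M" if j: "1 \<le> j" "j \<le> Suc n" for j
      proof (cases "j = Suc n")
        case True
        then show ?thesis using r fP by (simp add: monom_mult_is_smult)
      next
        case False
        then have "coeff P f j \<in> M" using fA j by (auto simp: truncation_ring_def)
        then show ?thesis
          using False r fP by (simp add: monom_mult_is_smult a_minus_def M.I_l_closed)
      qed
      then show ?thesis using r fP by (simp add: truncation_ring_def)
    qed
    then have "?rf \<ominus>\<^bsub>P\<^esub> ?x \<in> T" using BT by blast
    then have "?rf \<oplus>\<^bsub>P\<^esub> \<ominus>\<^bsub>P\<^esub> (?rf \<ominus>\<^bsub>P\<^esub> ?x) \<in> T"
      using subringE(5,7)[OF subT] rfT by blast
    moreover have "?rf \<oplus>\<^bsub>P\<^esub> \<ominus>\<^bsub>P\<^esub> (?rf \<ominus>\<^bsub>P\<^esub> ?x) = ?x"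
    proof -
      have "?rf \<in> carrier P" "?x \<in> carrier P" using r fP by simp_all
      then show ?thesis by algebra
    qed
    ultimately have xT: "?x \<in> T" by simp
    \<comment> \<open>subtracting the term of degree \<open>n + 1\<close> takes \<open>g\<close> into the smaller ring\<close>
    have "g \<in> T" if gA: "g \<in> ?A" for g
    proof -
      have gP: "g \<in> carrier P" using gA truncation_ring_carrier by blast
      let ?l = "?c (coeff P g (Suc n)) \<otimes>\<^bsub>P\<^esub> ?x"
      have lT: "?l \<in> T" using subringE(6)[OF subT] cT xT gP by simp
      have "coeff P (g \<ominus>\<^bsub>P\<^esub> ?l) j \<in> M" if j: "1 \<le> j" "j \<le> Suc n" for j
      proof (cases "j = Suc n")
        case True
        then show ?thesis using gP by (simp add: monom_mult_is_smult a_minus_def R.r_neg)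
      next
        case False
        then have "coeff P g j \<in> M" using gA j by (auto simp: truncation_ring_def)
        then show ?thesis
          using False gP by (simp add: monom_mult_is_smult a_minus_def)
      qed
      then have "g \<ominus>\<^bsub>P\<^esub> ?l \<in> T" using BT gP by (auto simp: truncation_ring_def)
      then have "(g \<ominus>\<^bsub>P\<^esub> ?l) \<oplus>\<^bsub>P\<^esub> ?l \<in> T" using subringE(7)[OF subT] lT by blast
      moreover have "(g \<ominus>\<^bsub>P\<^esub> ?l) \<oplus>\<^bsub>P\<^esub> ?l = g"
      proof -
        have "?l \<in> carrier P" using gP by simp
        then show ?thesis using gP by algebra
      qed
      ultimately show ?thesis by simp
    qed
    with TA show "T = ?A" by blast
  qed
  then show "maximal_subring ?B (P\<lparr>carrier := ?A\<rparr>)"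
    unfolding maximal_subring_def
    using P.subring_restrict[OF subA subB] strict by auto
qed

text \<open>Such a \<open>g\<close> is divisible by \<open>x\<close>, so \<open>g\<^sup>n\<close> is divisible by \<open>x\<^sup>n\<close>.\<close>
lemma coeff_power_below:
  assumes "g \<in> carrier P" "coeff P g 0 = \<zero>" "j < n"
  shows "coeff P (g [^]\<^bsub>P\<^esub> n) j = \<zero>"
  using assms(3)
proof (induction n arbitrary: j)
  case (Suc n)
  have "coeff P (g [^]\<^bsub>P\<^esub> n) i \<otimes> coeff P g (j - i) = \<zero>" if "i \<le> j" for i
  proof (cases "i < n")
    case True
    then show ?thesis using Suc.IH assms(1) by simp
  next
    case False
    then have "j - i = 0" using that Suc.prems by simp
    then show ?thesis using assms(1,2) by simp
  qed
  then have "(\<Oplus>i\<in>{..j}. coeff P (g [^]\<^bsub>P\<^esub> n) i \<otimes> coeff P g (j - i)) = (\<Oplus>i\<in>{..j}. \<zero>)"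
    by (intro R.finsum_cong') auto
  then show ?case using assms(1) by simp
qed simp

text \<open>
  The translate of \<open>f\<close> by its constant term has a power without terms of degree at most \<open>n\<close>, and
  such polynomials lie in the ring whatever their higher coefficients are.
\<close>
lemma integral_over_truncation_ring:
  assumes "ideal M R"
  shows "integral_over P (truncation_ring M n)"
proof -
  let ?S = "truncation_ring M n"
  note S = truncation_ring_subring[OF assms, of n]
  have zM: "\<zero> \<in> M" using additive_subgroup.zero_closed[OF ideal.axioms(1)[OF assms]] .
  have "integral_element P ?S f" if f: "f \<in> carrier P" for f
  proof (rule P.integral_if_shifted_power_in_subring[OF S f])
    let ?a = "monom P (coeff P f 0) 0"
    show "?a \<in> ?S" using const_in_truncation_ring[OF assms] f by simp
    show "0 < Suc n" by simp
    have "coeff P (f \<ominus>\<^bsub>P\<^esub> ?a) 0 = \<zero>" using f by (simp add: a_minus_def R.r_neg)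
    then show "(f \<ominus>\<^bsub>P\<^esub> ?a) [^]\<^bsub>P\<^esub> Suc n \<in> ?S"
      using f zM coeff_power_below[of "f \<ominus>\<^bsub>P\<^esub> ?a" _ "Suc n"]
      by (auto simp: truncation_ring_def simp del: P.nat_pow_Suc)
  qed
  with S show ?thesis by (simp add: integral_over_def)
qed

end

section \<open>The chain\<close>

theorem corollary3p7:
  fixes R :: "('a, 'm) ring_scheme"
  assumes "cring R" and "\<one>\<^bsub>R\<^esub> \<noteq> \<zero>\<^bsub>R\<^esub>"
  shows "\<exists>C :: nat \<Rightarrow> (nat \<Rightarrow> 'a) set.
           C 0 = carrier (UP R) \<and>
           (\<forall>i\<ge>1. C i \<subset> C (i - 1) \<and>
                  maximal_subring (C i) ((UP R)\<lparr>carrier := C (i - 1)\<rparr>) \<and>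
                  integral_over (UP R) (C i))"
proof -
  interpret UP_cring R "UP R" using assms(1) by (simp add: UP_cring_def)
  obtain M where M: "maximalideal M R"
    using R.exists_maximalideal assms(2) by blast
  then have "ideal M R" by (rule maximalideal.axioms(1))
  show ?thesis
  proof (intro exI[of _ "truncation_ring M"] conjI allI impI)
    show "truncation_ring M 0 = carrier (UP R)" by (rule truncation_ring_zero)
    fix i :: nat
    assume "1 \<le> i"
    then obtain n where i: "i = Suc n" by (cases i) auto
    show "truncation_ring M i \<subset> truncation_ring M (i - 1)"
      "maximal_subring (truncation_ring M i) ((UP R)\<lparr>carrier := truncation_ring M (i - 1)\<rparr>)"
      unfolding i using truncation_ring_maximal[OF M] by simp_all
    show "integral_over (UP R) (truncation_ring M i)"
      by (rule integral_over_truncation_ring) fact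
  qed
qed

end
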